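(* Let $X=X_k$ be one of the K3 surfaces (over $\mathbb{C}$) listed in the context, where $k=|H_X|\in\{66,44,42,36,28,12\}\cup\{3,9,27,5,25,7,11,13,17,19\}$. If $k\neq 3$, then $X$ is covered by the Fermat surface $\mathcal{F}_m: x_0^m+x_1^m+x_2^m+x_3^m=0\subset\mathbb{P}^3$ (i.e. there is a dominant rational map $\mathcal{F}_m\dashrightarrow X$), where $m=k$ if $X$ is unimodular (i.e. $k\in\{66,44,42,36,28,12\}$), and $m=2k$ if $X$ is non-unimodular (i.e. $k\in\{9,27,5,25,7,11,13,17,19\}$).
   Context: For a complex algebraic K3 surface $X$, $S_X$ and $T_X$ are the lattices of algebraic and transcendental cycles (so $S_X$ is the Néron–Severi lattice and $T_X=S_X^\perp\subset H^2(X,\mathbb{Z})$), and $H_X=\ker(\mathrm{Aut}(X)\to O(S_X))$, a finite cyclic group. For each $k$ below, $X_k$ is the K3 surface (unique up to isomorphism) with $|H_X|=k$ and $\mathrm{rank}(T_X)=\phi(k)$; $X_k$ is called unimodular if $T_X$ is unimodular and non-unimodular otherwise. Explicitly $X_k$ is the smooth minimal projective model of the following affine surface. Unimodular: $k=66$: $y^2=x^3-t(t^{11}+1)$; $k=44$: $y^2=x^3+x+t^{11}$; $k=42$: $y^2=x^3-t^5(t^7+1)$; $k=36$: $y^2=x^3-t^5(t^6+1)$; $k=28$: $y^2=x^3+x+t^7$; $k=12$: $y^2=x^3+t^5(t^2+1)$. Non-unimodular: $k=19$: $y^2=x^3+t^7x-t$; $k=17$: $y^2=x^3+t^7x-t^2$;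 $k=13$: $y^2=x^3+t^5x-t$; $k=11$: $y^2=x^3+t^5x-t^2$; $k=7$: $y^2=x^3+t^3x-t^8$; $k=5$: $y^2=x^3+t^3x-t^7$; $k=27$: $y^2=x^3-t(t^9+1)$; $k=9$: $y^2=x^3-t^5(t^3+1)$; $k=3$: $y^2=x^3+t^5(t-1)^2$; $k=25$: $y^2=u^5+uv^5-1$ (a double sextic). *)

theory Defs
  imports "HOL-Analysis.Analysis" "HOL-Library.Function_Algebras"
begin

text \<open>
  Vectors have type \<^typ>\<open>nat \<Rightarrow> complex\<close>, so that the dimension of the ambient space can be
  quantified over.  A subset of projective \<open>n\<close>-space is represented by the set of all homogeneous
  coordinate vectors of its points.
\<close>

definition proj_space :: "nat \<Rightarrow> (nat \<Rightarrow> complex) set" where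
  "proj_space n = {x. (\<exists>i. x i \<noteq> 0) \<and> (\<forall>i>n. x i = 0)}"

definition same_point :: "(nat \<Rightarrow> complex) \<Rightarrow> (nat \<Rightarrow> complex) \<Rightarrow> bool" where
  "same_point x y \<longleftrightarrow> (\<exists>c. c \<noteq> 0 \<and> y = (\<lambda>i. c * x i))"

text \<open>
  \<open>form n d f\<close>: \<open>f\<close> is a homogeneous polynomial of degree \<open>d\<close> in the coordinates \<open>0, \<dots>, n\<close>.
  Since the complex field is infinite, polynomials are identified with polynomial functions.
\<close>

inductive form :: "nat \<Rightarrow> nat \<Rightarrow> ((nat \<Rightarrow> complex) \<Rightarrow> complex) \<Rightarrow> bool" for n :: nat where
  const: "form n 0 (\<lambda>x. c)"
| coord: "i \<le> n \<Longrightarrow> form n 1 (\<lambda>x. x i)"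
| add: "form n d f \<Longrightarrow> form n d g \<Longrightarrow> form n d (\<lambda>x. f x + g x)"
| mult: "form n d f \<Longrightarrow> form n e g \<Longrightarrow> form n (d + e) (\<lambda>x. f x * g x)"

text \<open>The basic open sets are stable under scaling, hence so are all open and closed sets.\<close>

definition zariski :: "nat \<Rightarrow> (nat \<Rightarrow> complex) topology" where
  "zariski n = topology_generated_by {{x \<in> proj_space n. f x \<noteq> 0} | d f. form n d f}"

definition irreducible_space :: "'a topology \<Rightarrow> bool" where
  "irreducible_space T \<longleftrightarrow> topspace T \<noteq> {} \<and>
     (\<forall>Z W. closedin T Z \<and> closedin T W \<and> topspace T = Z \<union> W \<longrightarrow> topspace T = Z \<or> topspace T = W)"

definition has_chain :: "'a topology \<Rightarrow> nat \<Rightarrow> bool" where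
  "has_chain T d \<longleftrightarrow> (\<exists>C. (\<forall>i\<le>d. closedin T (C i) \<and> irreducible_space (subtopology T (C i))) \<and>
     (\<forall>i<d. C i \<subset> C (Suc i)))"

definition has_krull_dim :: "'a topology \<Rightarrow> nat \<Rightarrow> bool" where
  "has_krull_dim T d \<longleftrightarrow> has_chain T d \<and> \<not> has_chain T (Suc d)"

definition projective_variety :: "nat \<Rightarrow> (nat \<Rightarrow> complex) set \<Rightarrow> bool" where
  "projective_variety n X \<longleftrightarrow>
     closedin (zariski n) X \<and> irreducible_space (subtopology (zariski n) X)"

definition form_map :: "nat \<Rightarrow> nat \<Rightarrow> nat \<Rightarrow> ((nat \<Rightarrow> complex) \<Rightarrow> (nat \<Rightarrow> complex)) \<Rightarrow> bool" where
  "form_map n m d F \<longleftrightarrow> (\<forall>j\<le>m. form n d (\<lambda>x. F x j)) \<and> (\<forall>j>m. \<forall>x. F x j = 0)"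

text \<open>
  A regular map acts on homogeneous coordinate vectors and is only relevant up to scaling; locally
  it is given by forms of the same degree.  These do not vanish simultaneously, because the zero
  vector represents no point of \<open>Y\<close>.
\<close>

definition regular_map ::
  "nat \<Rightarrow> (nat \<Rightarrow> complex) set \<Rightarrow> nat \<Rightarrow> (nat \<Rightarrow> complex) set \<Rightarrow>
   ((nat \<Rightarrow> complex) \<Rightarrow> (nat \<Rightarrow> complex)) \<Rightarrow> bool" where
  "regular_map n X m Y \<phi> \<longleftrightarrow> (\<forall>x\<in>X. \<phi> x \<in> Y) \<and>
     (\<forall>x\<in>X. \<exists>U d F. openin (zariski n) U \<and> x \<in> U \<and> form_map n m d F \<and>
        (\<forall>z\<in>X \<inter> U. same_point (F z) (\<phi> z)))"

definition iso_map ::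
  "nat \<Rightarrow> (nat \<Rightarrow> complex) set \<Rightarrow> nat \<Rightarrow> (nat \<Rightarrow> complex) set \<Rightarrow>
   ((nat \<Rightarrow> complex) \<Rightarrow> (nat \<Rightarrow> complex)) \<Rightarrow> bool" where
  "iso_map n X m Y \<phi> \<longleftrightarrow> regular_map n X m Y \<phi> \<and>
     (\<exists>\<psi>. regular_map m Y n X \<psi> \<and>
        (\<forall>x\<in>X. same_point x (\<psi> (\<phi> x))) \<and> (\<forall>y\<in>Y. same_point y (\<phi> (\<psi> y))))"

text \<open>
  In the following definitions \<open>X\<close> and \<open>Y\<close> are irreducible, so a rational map is a regular map on
  some nonempty open subset, and a birational map is an isomorphism of nonempty open subsets.
\<close>

definition nonempty_open_in :: "nat \<Rightarrow> (nat \<Rightarrow> complex) set \<Rightarrow> (nat \<Rightarrow> complex) set \<Rightarrow> bool" where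
  "nonempty_open_in n X U \<longleftrightarrow> U \<noteq> {} \<and> openin (subtopology (zariski n) X) U"

definition birational ::
  "nat \<Rightarrow> (nat \<Rightarrow> complex) set \<Rightarrow> nat \<Rightarrow> (nat \<Rightarrow> complex) set \<Rightarrow> bool" where
  "birational n X m Y \<longleftrightarrow>
     (\<exists>U V \<phi>. nonempty_open_in n X U \<and> nonempty_open_in m Y V \<and> iso_map n U m V \<phi>)"

definition birational_morphism ::
  "nat \<Rightarrow> (nat \<Rightarrow> complex) set \<Rightarrow> nat \<Rightarrow> (nat \<Rightarrow> complex) set \<Rightarrow>
   ((nat \<Rightarrow> complex) \<Rightarrow> (nat \<Rightarrow> complex)) \<Rightarrow> bool" where
  "birational_morphism n X m Y \<phi> \<longleftrightarrow> regular_map n X m Y \<phi> \<and>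
     (\<exists>U V. nonempty_open_in n X U \<and> nonempty_open_in m Y V \<and> iso_map n U m V \<phi>)"

text \<open>\<open>covers n X m Y\<close>: there is a dominant rational map from \<open>X\<close> to \<open>Y\<close>.\<close>

definition covers ::
  "nat \<Rightarrow> (nat \<Rightarrow> complex) set \<Rightarrow> nat \<Rightarrow> (nat \<Rightarrow> complex) set \<Rightarrow> bool" where
  "covers n X m Y \<longleftrightarrow>
     (\<exists>U \<phi>. nonempty_open_in n X U \<and> regular_map n U m Y \<phi> \<and> Y \<subseteq> zariski m closure_of (\<phi> ` U))"

text \<open>
  The tangent space at \<open>x\<close> of the affine cone over \<open>X\<close>, cut out by the differentials of all forms
  vanishing on \<open>X\<close>; by the Jacobian criterion, \<open>X\<close> is smooth at \<open>x\<close> iff its dimension exceeds the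
  dimension of \<open>X\<close> by one.
\<close>

definition cone_tangent_space ::
  "nat \<Rightarrow> (nat \<Rightarrow> complex) set \<Rightarrow> (nat \<Rightarrow> complex) \<Rightarrow> (nat \<Rightarrow> complex) set" where
  "cone_tangent_space n X x = {v. (\<forall>i>n. v i = 0) \<and>
     (\<forall>d f. form n d f \<and> (\<forall>y\<in>X. f y = 0) \<longrightarrow>
        (\<Sum>i\<le>n. deriv (\<lambda>z. f (x(i := z))) (x i) * v i) = 0)}"

definition smooth_projective_surface :: "nat \<Rightarrow> (nat \<Rightarrow> complex) set \<Rightarrow> bool" where
  "smooth_projective_surface n X \<longleftrightarrow>
     projective_variety n X \<and> has_krull_dim (subtopology (zariski n) X) 2 \<and>
     (\<forall>x\<in>X. vector_space.dim (\<lambda>(c::complex) v i. c * v i) (cone_tangent_space n X x) = 2 + 1)"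

definition minimal_surface :: "nat \<Rightarrow> (nat \<Rightarrow> complex) set \<Rightarrow> bool" where
  "minimal_surface n X \<longleftrightarrow> smooth_projective_surface n X \<and>
     (\<forall>m Y \<phi>. smooth_projective_surface m Y \<and> birational_morphism n X m Y \<phi> \<longrightarrow> iso_map n X m Y \<phi>)"

definition smooth_minimal_projective_model ::
  "nat \<Rightarrow> (nat \<Rightarrow> complex) set \<Rightarrow> nat \<Rightarrow> (nat \<Rightarrow> complex) set \<Rightarrow> bool" where
  "smooth_minimal_projective_model n X m S \<longleftrightarrow> minimal_surface n X \<and> birational n X m S"

definition fermat_surface :: "nat \<Rightarrow> (nat \<Rightarrow> complex) set" where
  "fermat_surface m = {x \<in> proj_space 3. x 0 ^ m + x 1 ^ m + x 2 ^ m + x 3 ^ m = 0}"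

definition unimodular_orders :: "nat set" where
  "unimodular_orders = {66, 44, 42, 36, 28, 12}"

definition non_unimodular_orders :: "nat set" where
  "non_unimodular_orders = {3, 9, 27, 5, 25, 7, 11, 13, 17, 19}"

text \<open>
  The affine surfaces are given by an equation \<open>y\<^sup>2 = K3_rhs k x t\<close>.  For \<open>k = 25\<close> the variables
  \<open>x\<close> and \<open>t\<close> stand for the affine coordinates \<open>u\<close> and \<open>v\<close> of the plane underlying a double sextic.
\<close>

definition K3_rhs :: "nat \<Rightarrow> complex \<Rightarrow> complex \<Rightarrow> complex" where
  "K3_rhs k x t =
    (if k = 66 then x^3 - t * (t^11 + 1)
     else if k = 44 then x^3 + x + t^11
     else if k = 42 then x^3 - t^5 * (t^7 + 1)
     else if k = 36 then x^3 - t^5 * (t^6 + 1)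
     else if k = 28 then x^3 + x + t^7
     else if k = 12 then x^3 + t^5 * (t^2 + 1)
     else if k = 19 then x^3 + t^7 * x - t
     else if k = 17 then x^3 + t^7 * x - t^2
     else if k = 13 then x^3 + t^5 * x - t
     else if k = 11 then x^3 + t^5 * x - t^2
     else if k = 7 then x^3 + t^3 * x - t^8
     else if k = 5 then x^3 + t^3 * x - t^7
     else if k = 27 then x^3 - t * (t^9 + 1)
     else if k = 9 then x^3 - t^5 * (t^3 + 1)
     else if k = 3 then x^3 + t^5 * (t - 1)^2
     else if k = 25 then x^5 + x * t^5 - 1
     else undefined)"

definition K3_affine :: "nat \<Rightarrow> (complex \<times> complex \<times> complex) set" where
  "K3_affine k = {(x, y, t). y^2 = K3_rhs k x t}"

text \<open>Affine 3-space is embedded as the chart of projective 3-space where coordinate 0 is nonzero.\<close>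

definition affine_chart :: "(complex \<times> complex \<times> complex) set \<Rightarrow> (nat \<Rightarrow> complex) set" where
  "affine_chart S = {v \<in> proj_space 3. v 0 \<noteq> 0 \<and> (v 1 / v 0, v 2 / v 0, v 3 / v 0) \<in> S}"

definition K3_model :: "nat \<Rightarrow> nat \<Rightarrow> (nat \<Rightarrow> complex) set \<Rightarrow> bool" where
  "K3_model k n X \<longleftrightarrow> smooth_minimal_projective_model n X 3 (affine_chart (K3_affine k))"

end

theory Submission
  imports Defs
begin

text \<open>
  Every surface in the list with \<open>k \<noteq> 3\<close> has an equation with four monomials,
  \<open>y\<^sup>2 = x\<^sup>p + c x\<^sup>q t\<^sup>r + d t\<^sup>s\<close> with \<open>q < p\<close> (for \<open>k = 3\<close> the square \<open>(t - 1)\<^sup>2\<close> brings in a fifth).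
  Such surfaces are Delsarte surfaces, and Shioda's method covers them by Fermat surfaces: one
  looks for Laurent monomials \<open>x\<close>, \<open>y\<close>, \<open>t\<close> of degree zero in the coordinates
  \<open>W\<^sub>0, \<dots>, W\<^sub>3\<close> that turn \<open>y\<^sup>2\<close>, \<open>x\<^sup>p\<close>, \<open>x\<^sup>q t\<^sup>r\<close>, \<open>t\<^sup>s\<close> into \<open>W\<^sub>0\<^sup>m, \<dots>, W\<^sub>3\<^sup>m\<close>
  times one common monomial.  Then the equation becomes a diagonal equation of degree \<open>m\<close>, and
  multiplying each \<open>W\<^sub>i\<close> by a constant makes it the Fermat equation.

  In terms of logarithms this is a linear system.  Up to sign, its determinant is \<open>2D\<close> with
  \<open>D = p (r - s) + q s\<close>, so by Cramer's rule \<open>m = 2\<bar>D\<bar>\<close> admits a solution in integers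
  (\<open>delsarte_exponents\<close>).  Since \<open>D \<noteq> 0\<close>, the system can also be solved for the logarithms of
  the \<open>W\<^sub>i\<close> in terms of those of \<open>x\<close>, \<open>y\<close>, \<open>t\<close>; so every point of the surface with nonzero
  coordinates is in the image.  These points are dense (\<open>delsarte_torus_dense\<close>), hence the monomial
  map is dominant (\<open>fermat_covers_delsarte\<close>).  For the surfaces in question \<open>\<bar>D\<bar>\<close> is \<open>k / 2\<close> in
  the unimodular and \<open>k\<close> in the non-unimodular cases, which gives the two values of \<open>m\<close>.

  Finally, a dominant rational map to the affine surface yields one to its smooth projective
  model, by composition with a birational map (\<open>covers_birational\<close>).
\<close>

section \<open>Forms and the Zariski topology\<close>

lemma form_homogeneous:
  assumes "form n d f"
  shows "f (\<lambda>i. c * x i) = c ^ d * f x"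
  using assms by induction (auto simp: algebra_simps power_add)

lemma form_compose:
  assumes "form m d f" and "form_map n m e F"
  shows "form n (d * e) (\<lambda>x. f (F x))"
  using assms(1)
proof induction
  case (const c)
  then show ?case using form.const[of n c] by simp
next
  case (coord i)
  then show ?case using assms(2) by (simp add: form_map_def)
next
  case (add d f g)
  then show ?case by (intro form.add)
next
  case (mult d f d' g)
  then show ?case by (simp add: add_mult_distrib form.mult)
qed

lemma form_map_compose:
  assumes "form_map m l e G" and "form_map n m d F"
  shows "form_map n l (e * d) (\<lambda>x. G (F x))"
  using assms form_compose[of m e _ n d F] by (auto simp: form_map_def)

lemma form_power:
  assumes "form n d f"
  shows "form n (k * d) (\<lambda>x. f x ^ k)"
proof (induction k)
  case 0
  then show ?case using form.const[of n 1] by simp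
next
  case (Suc k)
  then show ?case using form.mult[OF assms Suc] by simp
qed

lemma form_prod:
  fixes k :: nat
  assumes "\<And>i. i \<le> k \<Longrightarrow> form n (d i) (f i)"
  shows "form n (\<Sum>i\<le>k. d i) (\<lambda>x. \<Prod>i\<le>k. f i x)"
  using assms
proof (induction k)
  case 0
  then show ?case by simp
next
  case (Suc k)
  then show ?case using form.mult[of n "\<Sum>i\<le>k. d i" _ "d (Suc k)" "f (Suc k)"] by simp
qed

lemma form_continuous:
  fixes g :: "'a::topological_space \<Rightarrow> nat \<Rightarrow> complex"
  assumes "form n d f" and "\<And>i. continuous_on UNIV (\<lambda>z. g z i)"
  shows "continuous_on UNIV (\<lambda>z. f (g z))"
  using assms(1) by induction (auto intro!: continuous_intros assms(2))

lemma openin_zariski_basic: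
  "form n d f \<Longrightarrow> openin (zariski n) {x \<in> proj_space n. f x \<noteq> 0}"
  unfolding zariski_def by (rule topology_generated_by_Basis) blast

lemma topspace_zariski [simp]: "topspace (zariski n) = proj_space n"
proof -
  have "{x \<in> proj_space n. (\<lambda>x. 1) x \<noteq> (0::complex)} \<subseteq> topspace (zariski n)"
    by (intro openin_subset openin_zariski_basic[OF form.const])
  then show ?thesis
    unfolding zariski_def by (auto simp: topology_generated_by_topspace)
qed

lemma zariski_open_induct [consumes 1, case_names empty inter union basic]:
  assumes "openin (zariski n) T"
    and "P {}"
    and "\<And>A B. P A \<Longrightarrow> P B \<Longrightarrow> P (A \<inter> B)"
    and "\<And>K. (\<And>A. A \<in> K \<Longrightarrow> P A) \<Longrightarrow> P (\<Union>K)"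
    and "\<And>d f. form n d f \<Longrightarrow> P {x \<in> proj_space n. f x \<noteq> 0}"
  shows "P T"
proof -
  have "generate_topology_on {{x \<in> proj_space n. f x \<noteq> 0} | d f. form n d f} T"
    using assms(1) unfolding zariski_def by (simp add: openin_topology_generated_by_iff)
  then show ?thesis
    by induction (use assms(2-) in \<open>auto 0 3\<close>)
qed

lemma same_point_proj_space:
  "same_point x y \<Longrightarrow> x \<in> proj_space n \<Longrightarrow> y \<in> proj_space n"
  by (auto simp: same_point_def proj_space_def)

lemma same_point_sym: "same_point x y \<Longrightarrow> same_point y x"
  unfolding same_point_def
proof (elim exE conjE)
  fix c :: complex assume "c \<noteq> 0" "y = (\<lambda>i. c * x i)"
  then show "\<exists>c. c \<noteq> 0 \<and> x = (\<lambda>i. c * y i)" by (intro exI[of _ "1/c"]) auto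
qed

lemma same_point_trans: "same_point x y \<Longrightarrow> same_point y z \<Longrightarrow> same_point x z"
  unfolding same_point_def
proof (elim exE conjE)
  fix c d :: complex assume "c \<noteq> 0" "y = (\<lambda>i. c * x i)" "d \<noteq> 0" "z = (\<lambda>i. d * y i)"
  then show "\<exists>c. c \<noteq> 0 \<and> z = (\<lambda>i. c * x i)" by (intro exI[of _ "d * c"]) auto
qed

text \<open>
  Points are represented by all their coordinate vectors, so membership in an open set has to be
  transported along \<open>same_point\<close>; it suffices that forms are homogeneous.
\<close>

lemma zariski_open_same_point:
  assumes "openin (zariski n) T"
  shows "same_point x y \<Longrightarrow> x \<in> T \<Longrightarrow> y \<in> T"
  using assms
proof (induction rule: zariski_open_induct)
  case (basic d f)
  from basic.prems obtain c where "c \<noteq> 0" "y = (\<lambda>i. c * x i)"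
    by (auto simp: same_point_def)
  with form_homogeneous[OF basic.hyps] same_point_proj_space[OF basic.prems(1)] basic.prems(2)
  show ?case by auto
qed auto

lemma form_map_same_point:
  assumes "form_map n m d F" and "same_point x y"
  shows "same_point (F x) (F y)"
proof -
  from assms(2) obtain c where c: "c \<noteq> 0" "y = (\<lambda>i. c * x i)"
    by (auto simp: same_point_def)
  have "F y j = c ^ d * F x j" for j
    using assms(1) form_homogeneous[of n d "\<lambda>x. F x j" c x] c
    by (cases "j \<le> m") (auto simp: form_map_def)
  then show ?thesis using c unfolding same_point_def by (intro exI[of _ "c ^ d"]) auto
qed

text \<open>
  The forms of \<open>F\<close> may have common zeros.  Where they do, \<open>F x\<close> represents no point and lies in no
  open set, so preimages of open sets are open in the whole projective space.
\<close>

lemma form_map_vimage_open: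
  assumes "openin (zariski m) T" and F: "form_map n m e F"
  shows "openin (zariski n) {x \<in> proj_space n. F x \<in> T}"
  using assms(1)
proof (induction rule: zariski_open_induct)
  case empty
  then show ?case by simp
next
  case (inter A B)
  have "{x \<in> proj_space n. F x \<in> A \<inter> B} =
      {x \<in> proj_space n. F x \<in> A} \<inter> {x \<in> proj_space n. F x \<in> B}" by auto
  then show ?case using inter by (simp add: openin_Int)
next
  case (union K)
  have "{x \<in> proj_space n. F x \<in> \<Union>K} = (\<Union>A\<in>K. {x \<in> proj_space n. F x \<in> A})" by auto
  then show ?case using union by (auto intro!: openin_Union)
next
  case (basic d f)
  have "{x \<in> proj_space n. F x \<in> {y \<in> proj_space m. f y \<noteq> 0}} =
      (\<Union>j\<in>{..m}. {x \<in> proj_space n. F x j \<noteq> 0}) \<inter> {x \<in> proj_space n. f (F x) \<noteq> 0}"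
    using F by (auto simp: form_map_def proj_space_def not_le[symmetric])
  moreover have "openin (zariski n) {x \<in> proj_space n. F x j \<noteq> 0}" if "j \<le> m" for j
    using F that by (intro openin_zariski_basic) (auto simp: form_map_def)
  moreover have "openin (zariski n) {x \<in> proj_space n. f (F x) \<noteq> 0}"
    by (intro openin_zariski_basic[OF form_compose[OF basic F]])
  ultimately show ?case by (auto intro!: openin_Union openin_Int)
qed

text \<open>
  The Euclidean topology is finer than the Zariski topology.  Points in a Zariski neighbourhood can
  therefore be found by small perturbations.
\<close>

lemma zariski_open_vimage_euclidean:
  fixes g :: "'a::topological_space \<Rightarrow> nat \<Rightarrow> complex"
  assumes "openin (zariski n) T" and cont: "\<And>i. continuous_on UNIV (\<lambda>z. g z i)"
    and proj: "\<And>z. g z \<in> proj_space n"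
  shows "open {z. g z \<in> T}"
  using assms(1)
proof (induction rule: zariski_open_induct)
  case (inter A B)
  then show ?case using open_Int[of "{z. g z \<in> A}" "{z. g z \<in> B}"] by (simp add: Int_def)
next
  case (union K)
  have "{z. g z \<in> \<Union>K} = (\<Union>A\<in>K. {z. g z \<in> A})" by auto
  then show ?case using union by auto
next
  case (basic d f)
  then show ?case
    using open_Collect_neq[OF form_continuous[OF basic cont] continuous_on_const[of _ 0]]
    by (simp add: proj)
qed simp

section \<open>Rational maps\<close>

lemma regular_map_vimage_open:
  assumes \<phi>: "regular_map n U m Y \<phi>" and T: "openin (zariski m) T"
  shows "openin (subtopology (zariski n) U) {x \<in> U. \<phi> x \<in> T}"
proof (subst openin_subopen, intro ballI)
  fix x assume "x \<in> {x \<in> U. \<phi> x \<in> T}"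
  then have x: "x \<in> U" "\<phi> x \<in> T" by auto
  with \<phi> obtain W d F where W: "openin (zariski n) W" "x \<in> W" "form_map n m d F"
    and F: "\<And>z. z \<in> U \<inter> W \<Longrightarrow> same_point (F z) (\<phi> z)"
    unfolding regular_map_def by blast
  let ?O = "W \<inter> {z \<in> proj_space n. F z \<in> T}"
  have "openin (zariski n) ?O"
    using W T by (intro openin_Int form_map_vimage_open)
  then have "openin (subtopology (zariski n) U) (U \<inter> ?O)"
    by (auto simp: openin_subtopology)
  moreover have "x \<in> U \<inter> ?O"
    using x W F[of x] zariski_open_same_point[OF T same_point_sym] openin_subset[OF W(1)] by auto
  moreover have "U \<inter> ?O \<subseteq> {x \<in> U. \<phi> x \<in> T}"
    using F zariski_open_same_point[OF T] by auto
  ultimately show "\<exists>O'. openin (subtopology (zariski n) U) O' \<and> x \<in> O' \<and> O' \<subseteq> {x \<in> U. \<phi> x \<in> T}"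
    by blast
qed

lemma regular_map_compose:
  assumes \<phi>: "regular_map n U m V \<phi>" and \<psi>: "regular_map m V l Y \<psi>"
  shows "regular_map n U l Y (\<psi> \<circ> \<phi>)"
  unfolding regular_map_def
proof (intro conjI ballI)
  fix x assume x: "x \<in> U"
  then show "(\<psi> \<circ> \<phi>) x \<in> Y" using \<phi> \<psi> by (auto simp: regular_map_def)
  have V: "\<phi> z \<in> V" if "z \<in> U" for z using \<phi> that by (auto simp: regular_map_def)
  from \<phi> x obtain W d F where W: "openin (zariski n) W" "x \<in> W" "form_map n m d F"
    and F: "\<And>z. z \<in> U \<inter> W \<Longrightarrow> same_point (F z) (\<phi> z)"
    unfolding regular_map_def by blast
  from \<psi> V[OF x] obtain W' e G where W': "openin (zariski m) W'" "\<phi> x \<in> W'" "form_map m l e G"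
    and G: "\<And>z. z \<in> V \<inter> W' \<Longrightarrow> same_point (G z) (\<psi> z)"
    unfolding regular_map_def by blast
  let ?O = "W \<inter> {z \<in> proj_space n. F z \<in> W'}"
  have "openin (zariski n) ?O"
    using W W' by (intro openin_Int form_map_vimage_open)
  moreover have "x \<in> ?O"
    using x W W' F[of x] zariski_open_same_point[OF W'(1) same_point_sym] openin_subset[OF W(1)]
    by auto
  moreover have "same_point (G (F z)) ((\<psi> \<circ> \<phi>) z)" if "z \<in> U \<inter> ?O" for z
  proof -
    have z: "same_point (F z) (\<phi> z)" using F that by auto
    then have "\<phi> z \<in> W'" using zariski_open_same_point[OF W'(1)] that by auto
    then have "same_point (G (\<phi> z)) (\<psi> (\<phi> z))" using G V that by auto
    then show ?thesis
      using same_point_trans[OF form_map_same_point[OF W'(3) z]] by simp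
  qed
  ultimately show "\<exists>W d F. openin (zariski n) W \<and> x \<in> W \<and> form_map n l d F \<and>
      (\<forall>z\<in>U \<inter> W. same_point (F z) ((\<psi> \<circ> \<phi>) z))"
    using form_map_compose[OF W'(3) W(3)] by blast
qed

lemma regular_map_restrict:
  assumes "regular_map n U m Y \<phi>" and "U' \<subseteq> U" and "\<And>x. x \<in> U' \<Longrightarrow> \<phi> x \<in> Y'"
  shows "regular_map n U' m Y' \<phi>"
  unfolding regular_map_def
proof (intro conjI ballI)
  fix x assume x: "x \<in> U'"
  then show "\<phi> x \<in> Y'" by (rule assms(3))
  from x assms(2) have "x \<in> U" by auto
  with assms(1) obtain W d F where W: "openin (zariski n) W" "x \<in> W" "form_map n m d F"
    and F: "\<And>z. z \<in> U \<inter> W \<Longrightarrow> same_point (F z) (\<phi> z)"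
    unfolding regular_map_def by blast
  then show "\<exists>W d F. openin (zariski n) W \<and> x \<in> W \<and> form_map n m d F \<and>
      (\<forall>z\<in>U' \<inter> W. same_point (F z) (\<phi> z))"
    using assms(2) by blast
qed

lemma irreducible_space_open_meet:
  assumes "irreducible_space T" "openin T A" "openin T B" "A \<noteq> {}" "B \<noteq> {}"
  shows "A \<inter> B \<noteq> {}"
proof
  assume "A \<inter> B = {}"
  moreover have "A \<subseteq> topspace T" "B \<subseteq> topspace T" using assms(2,3) openin_subset by auto
  ultimately have "topspace T = (topspace T - A) \<union> (topspace T - B)" by auto
  moreover have "closedin T (topspace T - A)" "closedin T (topspace T - B)"
    using assms(2,3) by auto
  ultimately have "topspace T = topspace T - A \<or> topspace T = topspace T - B"
    using assms(1) unfolding irreducible_space_def by blast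
  with assms(4,5) \<open>A \<subseteq> _\<close> \<open>B \<subseteq> _\<close> show False by blast
qed

text \<open>
  The composite is dominant: by irreducibility, a nonempty open subset of \<open>X\<close> meets the open
  subset that is isomorphic to one of \<open>S\<close>, so it corresponds to a nonempty open subset of \<open>S\<close>,
  which contains an image point by density.
\<close>

lemma covers_birational:
  assumes cov: "covers n F m S" and bir: "birational l X m S" and X: "projective_variety l X"
  shows "covers n F l X"
proof -
  from cov obtain U \<phi> where U: "nonempty_open_in n F U" and \<phi>: "regular_map n U m S \<phi>"
    and dense: "S \<subseteq> zariski m closure_of (\<phi> ` U)" unfolding covers_def by blast
  from bir obtain P V \<alpha> \<psi> where P: "nonempty_open_in l X P" and V: "nonempty_open_in m S V"
    and \<alpha>: "regular_map l P m V \<alpha>" and \<psi>: "regular_map m V l P \<psi>"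
    and inv: "\<And>x. x \<in> P \<Longrightarrow> same_point x (\<psi> (\<alpha> x))"
    unfolding birational_def iso_map_def by blast
  have XT: "X \<subseteq> proj_space l" "topspace (subtopology (zariski l) X) = X"
    using X closedin_subset[of "zariski l" X] by (auto simp: projective_variety_def)
  have PX: "P \<subseteq> X" and VS: "V \<subseteq> S" and UF: "U \<subseteq> F"
    using P V U openin_imp_subset by (auto simp: nonempty_open_in_def)
  from V obtain V0 where V0: "openin (zariski m) V0" "V = S \<inter> V0"
    by (auto simp: nonempty_open_in_def openin_subtopology)
  define U' where "U' = {x \<in> U. \<phi> x \<in> V}"
  have \<phi>S: "\<phi> x \<in> S" if "x \<in> U" for x using \<phi> that by (auto simp: regular_map_def)
  have "U' = {x \<in> U. \<phi> x \<in> V0}" using \<phi>S V0 by (auto simp: U'_def)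
  then have "openin (subtopology (zariski n) U) U'"
    using regular_map_vimage_open[OF \<phi> V0(1)] by simp
  then have "openin (subtopology (zariski n) F) U'"
    using U UF by (auto simp: nonempty_open_in_def openin_subtopology)
  moreover have X_closure: "\<exists>y. y \<in> (\<psi> \<circ> \<phi>) ` U' \<and> y \<in> T"
    if x: "x \<in> X" "x \<in> T" and T: "openin (zariski l) T" for x T
  proof -
    have "openin (subtopology (zariski l) X) (X \<inter> T)" using T by (auto simp: openin_subtopology)
    moreover have "irreducible_space (subtopology (zariski l) X)"
      "openin (subtopology (zariski l) X) P" "P \<noteq> {}" "X \<inter> T \<noteq> {}"
      using X P x by (auto simp: projective_variety_def nonempty_open_in_def)
    ultimately have "(X \<inter> T) \<inter> P \<noteq> {}" by (blast dest: irreducible_space_open_meet)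
    then obtain p where p: "p \<in> P" "p \<in> T" by auto
    then have \<alpha>p: "\<alpha> p \<in> V" "\<psi> (\<alpha> p) \<in> T"
      using \<alpha> inv zariski_open_same_point[OF T] by (auto simp: regular_map_def)
    from regular_map_vimage_open[OF \<psi> T] obtain T0
      where T0: "openin (zariski m) T0" "{q \<in> V. \<psi> q \<in> T} = T0 \<inter> V"
      by (auto simp: openin_subtopology)
    have "\<alpha> p \<in> T0 \<inter> V0" using T0 V0 \<alpha>p by blast
    moreover have "\<alpha> p \<in> zariski m closure_of (\<phi> ` U)" using dense VS \<alpha>p by auto
    ultimately obtain u where u: "u \<in> U" "\<phi> u \<in> T0 \<inter> V0"
      using T0 V0 openin_Int[of "zariski m" T0 V0] unfolding in_closure_of by blast
    then have "\<phi> u \<in> V" using V0 \<phi>S by auto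
    moreover then have "\<psi> (\<phi> u) \<in> T" using T0 u by blast
    ultimately show ?thesis using u by (auto simp: U'_def)
  qed
  moreover have "U' \<noteq> {}"
  proof -
    obtain x where "x \<in> X" using P PX by (auto simp: nonempty_open_in_def)
    then show ?thesis
      using X_closure[of x "proj_space l"] XT openin_topspace[of "zariski l"] by auto
  qed
  moreover have "regular_map n U' l X (\<psi> \<circ> \<phi>)"
  proof (rule regular_map_restrict)
    show "regular_map n U' l P (\<psi> \<circ> \<phi>)"
      by (rule regular_map_compose[OF regular_map_restrict[OF \<phi>] \<psi>]) (auto simp: U'_def)
    then show "(\<psi> \<circ> \<phi>) x \<in> X" if "x \<in> U'" for x
      using that PX by (auto simp: regular_map_def)
  qed simp
  ultimately show ?thesis
    using XT unfolding covers_def nonempty_open_in_def in_closure_of subset_iff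
    by (intro exI[of _ U'] exI[of _ "\<psi> \<circ> \<phi>"]) (auto simp: in_closure_of)
qed

section \<open>Density of the torus in a Delsarte double plane\<close>

definition delsarte_double_plane :: "nat \<Rightarrow> nat \<Rightarrow> nat \<Rightarrow> nat \<Rightarrow> complex \<Rightarrow> complex \<Rightarrow>
    (complex \<times> complex \<times> complex) set" where
  "delsarte_double_plane p q r s c d = {(x, y, t). y^2 = x^p + c * x^q * t^r + d * t^s}"

text \<open>
  As \<open>q < p\<close>, the right-hand side is monic in \<open>x\<close>, so after moving \<open>t\<close> off zero only finitely many
  values of \<open>x\<close> make \<open>x\<close> or \<open>y\<close> vanish, and \<open>x\<close> can be moved off them.
\<close>

lemma delsarte_torus_dense:
  assumes "q < p" and "open T" and "(x, y, t) \<in> T" and "(x, y, t) \<in> delsarte_double_plane p q r s c d"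
  obtains x' y' t' where "(x', y', t') \<in> T" "(x', y', t') \<in> delsarte_double_plane p q r s c d"
    "x' \<noteq> 0" "y' \<noteq> 0" "t' \<noteq> 0"
proof -
  define f where "f = (\<lambda>(x, t). x^p + c * x^q * t^r + d * t^s :: complex)"
  obtain e where e: "e > 0" "\<And>z. dist z (x, y, t) < e \<Longrightarrow> z \<in> T"
    using assms(2,3) open_dist by blast
  have "isCont f (x, t)"
    unfolding f_def case_prod_unfold by (intro continuous_intros)
  moreover have "(e/3)^2 > 0" using e(1) by simp
  ultimately obtain \<delta> where \<delta>: "\<delta> > 0" "\<And>z. dist z (x, t) < \<delta> \<Longrightarrow> dist (f z) (f (x, t)) < (e/3)^2"
    unfolding continuous_at_eps_delta by blast
  define \<eta> where "\<eta> = min (\<delta>/2) (e/3)"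
  have \<eta>: "\<eta> > 0" "\<eta> \<le> \<delta>/2" "\<eta> \<le> e/3" using e \<delta> by (auto simp: \<eta>_def)
  have avoid: "\<exists>z\<in>ball w \<eta>. z \<notin> A" if "finite A" for A and w :: complex
    using that uncountable_ball[of \<eta> w] \<eta>(1) countable_finite[OF finite_subset[of "ball w \<eta>" A]]
    by blast
  obtain t' where t': "t' \<in> ball t \<eta>" "t' \<noteq> 0" using avoid[of "{0}" t] by auto
  define h where "h = monom 1 p + monom (c * t'^r) q + [:d * t'^s:]"
  have "coeff h p = 1" using assms(1) by (auto simp: h_def coeff_pCons split: nat.splits)
  then have "h \<noteq> 0" by auto
  then have "finite (insert 0 {z. poly h z = 0})" using poly_roots_finite by simp
  from avoid[OF this, of x] obtain x' where x': "x' \<in> ball x \<eta>" "x' \<noteq> 0" "poly h x' \<noteq> 0" by auto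
  then have f0: "f (x', t') \<noteq> 0" by (simp add: h_def f_def poly_monom algebra_simps)
  have d1: "dist (x', t') (x, t) \<le> dist x' x + dist t' t"
    by (simp add: dist_Pair_Pair sqrt_sum_squares_le_sum)
  have df: "dist (f (x', t')) (f (x, t)) < (e/3)^2"
    using \<delta>(2)[of "(x', t')"] d1 x' t' \<eta> by (simp add: dist_commute)
  define w where "w = csqrt (f (x', t'))"
  have w: "w^2 = f (x', t')" by (simp add: w_def)
  have y: "y^2 = f (x, t)" using assms(4) by (simp add: f_def delsarte_double_plane_def)
  \<comment> \<open>One of the two square roots \<open>w\<close>, \<open>-w\<close> is close to \<open>y\<close>, because the product of their
     distances to \<open>y\<close> is the distance of the squares.\<close>
  have "norm (w - y) * norm (w + y) < (e/3)^2"
  proof -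
    have "(w - y) * (w + y) = f (x', t') - f (x, t)"
      unfolding w[symmetric] y[symmetric] by (simp add: power2_eq_square algebra_simps)
    then show ?thesis using df by (simp add: dist_norm flip: norm_mult)
  qed
  then have "norm (w - y) < e/3 \<or> norm (w + y) < e/3"
    using e(1) mult_mono[of "e/3" "norm (w - y)" "e/3" "norm (w + y)"]
    unfolding power2_eq_square by linarith
  then obtain y' where y': "y'^2 = f (x', t')" "dist y' y < e/3"
  proof
    assume "norm (w + y) < e/3"
    moreover have "norm (- w - y) = norm (w + y)"
      using norm_minus_cancel[of "w + y"] by simp
    ultimately show ?thesis using w that[of "-w"] by (simp add: dist_norm)
  qed (use w that in \<open>auto simp: dist_norm\<close>)
  have "dist (x', y', t') (x, y, t) \<le> dist x' x + (dist y' y + dist t' t)"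
  proof -
    have "dist (x', y', t') (x, y, t) \<le> dist x' x + dist (y', t') (y, t)"
      unfolding dist_Pair_Pair[of x'] by (rule sqrt_sum_squares_le_sum) auto
    also have "dist (y', t') (y, t) \<le> dist y' y + dist t' t"
      unfolding dist_Pair_Pair by (rule sqrt_sum_squares_le_sum) auto
    finally show ?thesis by simp
  qed
  then have "(x', y', t') \<in> T" using e(2) x' y' t' \<eta> by (simp add: dist_commute)
  moreover have "(x', y', t') \<in> delsarte_double_plane p q r s c d" using y' by (simp add: f_def delsarte_double_plane_def)
  moreover have "y' \<noteq> 0" using y' f0 by auto
  ultimately show ?thesis using that x' t' by blast
qed

section \<open>The monomial map from the Fermat surface\<close>

text \<open>
  Laurent monomials of degree zero are the affine coordinates of a map given by forms: multiplying
  all of them by a high power of the product of the variables clears the denominators and changes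
  only the common factor \<open>l\<close>.  The weights \<open>\<kappa>\<close> account for the coefficients of the target surface.
\<close>

lemma laurent_monomial_map:
  fixes E :: "nat \<Rightarrow> nat \<Rightarrow> int" and \<kappa> :: "nat \<Rightarrow> complex"
  assumes "\<And>j. j \<le> m \<Longrightarrow> (\<Sum>i\<le>n. E j i) = 0" and "\<And>i. i \<le> n \<Longrightarrow> \<kappa> i \<noteq> 0"
  obtains e M where "form_map n m e M"
    and "\<And>x. (\<And>i. i \<le> n \<Longrightarrow> x i \<noteq> 0) \<Longrightarrow>
      \<exists>l\<noteq>0. \<forall>j\<le>m. M x j = l * (\<Prod>i\<le>n. (\<kappa> i * x i) powi E j i)"
proof -
  define N where "N = (\<Sum>j\<le>m. \<Sum>i\<le>n. \<bar>E j i\<bar>)"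
  have N: "0 \<le> N + E j i" if "j \<le> m" "i \<le> n" for i j
  proof -
    have "\<bar>E j i\<bar> \<le> (\<Sum>i\<le>n. \<bar>E j i\<bar>)" using that by (intro member_le_sum) auto
    also have "\<dots> \<le> N" unfolding N_def
      using that by (intro member_le_sum[of j _ "\<lambda>j. \<Sum>i\<le>n. \<bar>E j i\<bar>"]) (auto intro: sum_nonneg)
    finally show ?thesis by linarith
  qed
  define M where "M = (\<lambda>(x::nat \<Rightarrow> complex) j. if j \<le> m then \<Prod>i\<le>n. (\<kappa> i * x i) ^ nat (N + E j i) else 0)"
  define e where "e = nat (int (Suc n) * N)"
  have "form n e (\<lambda>x. M x j)" if j: "j \<le> m" for j
  proof -
    have "int (\<Sum>i\<le>n. nat (N + E j i) * 1) = (\<Sum>i\<le>n. N + E j i)"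
      using N j by (simp del: sum.atMost_Suc)
    also have "\<dots> = int (Suc n) * N" using assms(1)[OF j] by (simp add: sum.distrib)
    finally have "(\<Sum>i\<le>n. nat (N + E j i) * 1) = e" by (simp only: e_def flip: nat_int)
    moreover have "form n (\<Sum>i\<le>n. nat (N + E j i) * 1) (\<lambda>x. \<Prod>i\<le>n. (\<kappa> i * x i) ^ nat (N + E j i))"
      by (intro form_prod form_power) (use form.mult[OF form.const form.coord] in auto)
    ultimately show ?thesis using j by (simp add: M_def)
  qed
  then have "form_map n m e M" by (auto simp: form_map_def M_def)
  moreover have "\<exists>l\<noteq>0. \<forall>j\<le>m. M x j = l * (\<Prod>i\<le>n. (\<kappa> i * x i) powi E j i)"
    if x: "\<And>i. i \<le> n \<Longrightarrow> x i \<noteq> 0" for x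
  proof (intro exI[of _ "\<Prod>i\<le>n. (\<kappa> i * x i) powi N"] conjI allI impI)
    show "(\<Prod>i\<le>n. (\<kappa> i * x i) powi N) \<noteq> 0" using x assms(2) by simp
    fix j assume j: "j \<le> m"
    have "(\<kappa> i * x i) ^ nat (N + E j i) = (\<kappa> i * x i) powi N * (\<kappa> i * x i) powi E j i"
      if "i \<le> n" for i
    proof -
      have "(\<kappa> i * x i) ^ nat (N + E j i) = (\<kappa> i * x i) powi (N + E j i)"
        using N[OF j that] by (simp only: power_int_def if_True)
      then show ?thesis
        using x[OF that] assms(2)[OF that] by (subst power_int_add[symmetric]) auto
    qed
    then show "M x j = (\<Prod>i\<le>n. (\<kappa> i * x i) powi N) * (\<Prod>i\<le>n. (\<kappa> i * x i) powi E j i)"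
      using j by (simp add: M_def flip: prod.distrib)
  qed
  ultimately show ?thesis using that by blast
qed

lemma nonzero_complex_root:
  fixes a :: complex
  assumes "m > 0" "a \<noteq> 0"
  shows "\<exists>z. z \<noteq> 0 \<and> z ^ m = a"
proof (intro exI conjI)
  show "exp (Ln a / of_nat m) ^ m = a"
    using assms by (simp flip: exp_of_nat_mult)
qed simp

lemma sum_atMost_3: "(\<Sum>i\<le>(3::nat). f i) = f 0 + f 1 + f 2 + f 3"
  by (simp add: eval_nat_numeral)

text \<open>
  Row \<open>j\<close> lists the exponents of \<open>W\<^sub>0, \<dots>, W\<^sub>3\<close> in the \<open>j\<close>-th of \<open>1\<close>, \<open>x\<close>, \<open>y\<close>, \<open>t\<close>, the
  coordinates of the affine chart.  The rows are the solution by Cramer's rule of the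
  system described at the top; \<open>\<sigma>\<close> stands for the sign of the determinant, so that \<open>m = 2 \<sigma> D\<close>.
\<close>

definition delsarte_exponents :: "nat \<Rightarrow> nat \<Rightarrow> nat \<Rightarrow> nat \<Rightarrow> int \<Rightarrow> nat \<Rightarrow> nat \<Rightarrow> int" where
  "delsarte_exponents p q r s \<sigma> j i =
    [[0, 0, 0, 0],
     [0, 2 * \<sigma> * (int r - int s), 2 * \<sigma> * int s, - 2 * \<sigma> * int r],
     [\<sigma> * (int p * (int r - int s) + int q * int s), - \<sigma> * int q * int s, \<sigma> * int p * int s,
      - \<sigma> * int p * int r],
     [0, - 2 * \<sigma> * int q, 2 * \<sigma> * int p, - 2 * \<sigma> * (int p - int q)]] ! j ! i"

lemma delsarte_exponents_sum:
  "j \<le> 3 \<Longrightarrow> (\<Sum>i\<le>3. delsarte_exponents p q r s \<sigma> j i) = 0"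
  by (auto simp: le_Suc_eq eval_nat_numeral delsarte_exponents_def algebra_simps)

text \<open>
  The defining property of the exponents, in logarithms: with \<open>v 1\<close>, \<open>v 2\<close>, \<open>v 3\<close> the logarithms of
  \<open>x\<close>, \<open>y\<close>, \<open>t\<close> and \<open>w i\<close> that of \<open>W\<^sub>i\<close>, the four monomials of the equation are \<open>W\<^sub>i\<^sup>m\<close> up
  to the common factor \<open>exp \<mu>\<close>.
\<close>

lemma delsarte_exponents_logarithm:
  fixes p q r s :: nat and w :: "nat \<Rightarrow> complex" and \<sigma> :: int
  defines "m \<equiv> of_int (2 * \<sigma> * (int p * (int r - int s) + int q * int s))"
  defines "v j \<equiv> \<Sum>i\<le>3. of_int (delsarte_exponents p q r s \<sigma> j i) * w i"
  obtains \<mu> where "2 * v 2 = \<mu> + m * w 0" "of_nat p * v 1 = \<mu> + m * w 1"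
    "of_nat q * v 1 + of_nat r * v 3 = \<mu> + m * w 2" "of_nat s * v 3 = \<mu> + m * w 3"
proof -
  define \<mu> where "\<mu> = 2 * of_int \<sigma> *
    (- of_nat q * of_nat s * w 1 + of_nat p * of_nat s * w 2 - of_nat p * of_nat r * w 3)"
  show ?thesis
    by (rule that[of \<mu>]; unfold \<mu>_def m_def v_def sum_atMost_3 delsarte_exponents_def;
        simp add: algebra_simps)
qed

text \<open>
  Surjectivity onto the torus: a preimage is obtained by choosing for \<open>W\<^sub>i\<close> an \<open>m\<close>-th root of the
  corresponding monomial of the equation, with the roots made compatible by taking logarithms
  of \<open>x\<close>, \<open>y\<close>, \<open>t\<close> first.
\<close>

lemma delsarte_exponents_invert:
  fixes p q r s :: nat and a b t :: complex and \<sigma> :: int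
  defines "m \<equiv> of_int (2 * \<sigma> * (int p * (int r - int s) + int q * int s))"
  assumes m: "m \<noteq> 0"
  defines "w \<equiv> (!) [2 * b / m, of_nat p * a / m, (of_nat q * a + of_nat r * t) / m, of_nat s * t / m]"
  defines "v j \<equiv> \<Sum>i\<le>3. of_int (delsarte_exponents p q r s \<sigma> j i) * w i"
  shows "v 1 = a" "v 2 = b" "v 3 = t"
proof -
  show "v 1 = a" "v 2 = b" "v 3 = t"
    unfolding v_def w_def sum_atMost_3 delsarte_exponents_def using m
    by (simp_all add: divide_simps) (simp_all add: m_def algebra_simps)
qed

text \<open>
  The monomial map is used on the open set where no Fermat coordinate vanishes.  There all
  coordinates are exponentials, which reduces both inclusions, of the image in the surface and of
  the torus points of the surface in the image, to the preceding linear identities.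
\<close>

theorem fermat_covers_delsarte:
  fixes p q r s :: nat and c d :: complex
  defines "D \<equiv> int p * (int r - int s) + int q * int s"
  assumes "q < p" and "c \<noteq> 0" and "d \<noteq> 0" and "D \<noteq> 0"
  shows "covers 3 (fermat_surface (nat (2 * \<bar>D\<bar>))) 3 (affine_chart (delsarte_double_plane p q r s c d))"
proof -
  define \<sigma> where "\<sigma> = sgn D"
  define m where "m = nat (2 * \<bar>D\<bar>)"
  let ?F = "fermat_surface m" and ?S = "affine_chart (delsarte_double_plane p q r s c d)"
  let ?E = "delsarte_exponents p q r s \<sigma>"
  have m: "m > 0" using assms by (simp add: m_def)
  have m_eq: "of_int (2 * \<sigma> * (int p * (int r - int s) + int q * int s)) = (of_nat m :: complex)"
  proof -
    have "int m = 2 * \<bar>D\<bar>" by (simp add: m_def)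
    also have "\<dots> = 2 * \<sigma> * D" unfolding abs_sgn \<sigma>_def by (simp only: mult_ac)
    finally have "2 * \<sigma> * D = int m" ..
    then show ?thesis unfolding D_def by (simp only: of_int_of_nat_eq)
  qed
  \<comment> \<open>With \<open>W\<^sub>i = \<kappa>\<^sub>i X\<^sub>i\<close> the Fermat equation for \<open>X\<close> becomes
     \<open>W\<^sub>0\<^sup>m = W\<^sub>1\<^sup>m + c W\<^sub>2\<^sup>m + d W\<^sub>3\<^sup>m\<close>.\<close>
  obtain \<zeta> :: complex where "\<zeta> \<noteq> 0" "\<zeta> ^ m = -1"
    using nonzero_complex_root[OF m, of "-1"] by auto
  moreover obtain \<gamma> where "\<gamma> \<noteq> 0" "\<gamma> ^ m = 1 / c"
    using nonzero_complex_root[OF m, of "1 / c"] \<open>c \<noteq> 0\<close> by auto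
  moreover obtain \<epsilon> where "\<epsilon> \<noteq> 0" "\<epsilon> ^ m = 1 / d"
    using nonzero_complex_root[OF m, of "1 / d"] \<open>d \<noteq> 0\<close> by auto
  ultimately have roots: "\<zeta> \<noteq> 0" "\<zeta> ^ m = -1" "\<gamma> \<noteq> 0" "\<gamma> ^ m = 1 / c" "\<epsilon> \<noteq> 0" "\<epsilon> ^ m = 1 / d"
    by blast+
  define \<kappa> where "\<kappa> = (!) [\<zeta>, 1, \<gamma>, \<epsilon>]"
  have \<kappa>: "\<kappa> i \<noteq> 0" if "i \<le> 3" for i
    using that roots by (auto simp: \<kappa>_def le_Suc_eq eval_nat_numeral)
  have \<kappa>_simps: "\<kappa> 0 = \<zeta>" "\<kappa> 1 = 1" "\<kappa> 2 = \<gamma>" "\<kappa> 3 = \<epsilon>" by (simp_all add: \<kappa>_def)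
  obtain e M where M: "form_map 3 3 e M"
    and M_eq: "\<And>x. (\<And>i. i \<le> 3 \<Longrightarrow> x i \<noteq> 0) \<Longrightarrow>
      \<exists>l\<noteq>0. \<forall>j\<le>3. M x j = l * (\<Prod>i\<le>3. (\<kappa> i * x i) powi ?E j i)"
    using laurent_monomial_map[where m = 3 and n = 3 and E = ?E and \<kappa> = \<kappa>,
        OF delsarte_exponents_sum \<kappa>]
    by blast
  define U where "U = {x \<in> ?F. (\<Prod>i\<le>3. x i) \<noteq> 0}"
  have M_exp: "\<exists>l\<noteq>0. \<forall>j\<le>3. M x j = l * exp (\<Sum>i\<le>3. of_int (?E j i) * w i)"
    if x: "\<And>i. i \<le> 3 \<Longrightarrow> x i \<noteq> 0" and w: "\<And>i. i \<le> 3 \<Longrightarrow> \<kappa> i * x i = exp (w i)" for x w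
  proof -
    have "(\<Prod>i\<le>3. (\<kappa> i * x i) powi ?E j i) = exp (\<Sum>i\<le>3. of_int (?E j i) * w i)" for j
      unfolding exp_sum[OF finite_atMost] using w by (intro prod.cong) (auto simp: exp_power_int)
    moreover have "\<exists>l\<noteq>0. \<forall>j\<le>3. M x j = l * (\<Prod>i\<le>3. (\<kappa> i * x i) powi ?E j i)"
      by (rule M_eq) (rule x)
    ultimately show ?thesis by simp
  qed
  have M_proj: "M x \<in> proj_space 3" if "M x 0 \<noteq> 0" for x
    using M that by (auto simp: proj_space_def form_map_def)
  have E0: "(\<Sum>i\<le>3. of_int (?E 0 i) * w i) = 0" for w :: "nat \<Rightarrow> complex"
    by (simp add: sum_atMost_3 delsarte_exponents_def)
  have M_surface: "M x \<in> ?S" if "x \<in> U" for x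
  proof -
    have x: "x i \<noteq> 0" if "i \<le> 3" for i using \<open>x \<in> U\<close> that by (auto simp: U_def)
    define w where "w i = Ln (\<kappa> i * x i)" for i
    have w: "\<kappa> i * x i = exp (w i)" if "i \<le> 3" for i
      using x[OF that] \<kappa>[OF that] by (simp add: w_def)
    define v where "v j = (\<Sum>i\<le>3. of_int (?E j i) * w i)" for j
    obtain l where l: "l \<noteq> 0" "\<And>j. j \<le> 3 \<Longrightarrow> M x j = l * exp (v j)"
      using M_exp[of x w, OF x w] by (auto simp: v_def)
    obtain \<mu> where \<mu>: "2 * v 2 = \<mu> + of_nat m * w 0" "of_nat p * v 1 = \<mu> + of_nat m * w 1"
      "of_nat q * v 1 + of_nat r * v 3 = \<mu> + of_nat m * w 2" "of_nat s * v 3 = \<mu> + of_nat m * w 3"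
      using delsarte_exponents_logarithm[of p q r s \<sigma> w] unfolding m_eq v_def by blast
    have W: "exp (of_nat m * w i) = \<kappa> i ^ m * x i ^ m" if "i \<le> 3" for i
      by (simp add: exp_of_nat_mult flip: w[OF that] power_mult_distrib)
    have terms: "exp (v 2) ^ 2 = exp \<mu> * (\<kappa> 0 ^ m * x 0 ^ m)"
      "exp (v 1) ^ p = exp \<mu> * (\<kappa> 1 ^ m * x 1 ^ m)"
      "exp (v 1) ^ q * exp (v 3) ^ r = exp \<mu> * (\<kappa> 2 ^ m * x 2 ^ m)"
      "exp (v 3) ^ s = exp \<mu> * (\<kappa> 3 ^ m * x 3 ^ m)"
      using \<mu> by (simp_all add: exp_add flip: W exp_of_nat_mult) (simp flip: exp_add)
    have "x 0 ^ m + x 1 ^ m + x 2 ^ m + x 3 ^ m = 0"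
      using \<open>x \<in> U\<close> by (simp add: U_def fermat_surface_def)
    then have "- (x 0 ^ m) = x 1 ^ m + x 2 ^ m + x 3 ^ m"
      by (simp only: neg_eq_iff_add_eq_0 add.assoc)
    then have "exp (v 2) ^ 2 = exp (v 1) ^ p + c * (exp (v 1) ^ q * exp (v 3) ^ r) + d * exp (v 3) ^ s"
      using assms(3,4) unfolding terms \<kappa>_simps roots by (simp add: algebra_simps)
    then have "(exp (v 1), exp (v 2), exp (v 3)) \<in> delsarte_double_plane p q r s c d"
      by (simp add: delsarte_double_plane_def mult.assoc)
    moreover have "v 0 = 0" using E0 by (simp add: v_def)
    ultimately show ?thesis
      using l M_proj[of x] unfolding affine_chart_def by simp
  qed
  have dense: "\<exists>x\<in>U. M x \<in> T" if T: "openin (zariski 3) T" and "z \<in> ?S" "z \<in> T" for z T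
  proof -
    \<comment> \<open>The parametrization \<open>g\<close> of the chart is scaled by \<open>z 0\<close> so that it passes through the
       coordinate vector \<open>z\<close> itself.\<close>
    define g where "g = (\<lambda>(x, y, t) i. if i \<le> 3 then z 0 * [1, x, y, t] ! i else 0)"
    have z: "z \<in> proj_space 3" "z 0 \<noteq> 0"
      "(z 1 / z 0, z 2 / z 0, z 3 / z 0) \<in> delsarte_double_plane p q r s c d"
      using \<open>z \<in> ?S\<close> by (auto simp: affine_chart_def)
    have "g (z 1 / z 0, z 2 / z 0, z 3 / z 0) = z"
    proof
      fix i :: nat
      have "i = 0 \<or> i = 1 \<or> i = 2 \<or> i = 3 \<or> i > 3" by linarith
      then show "g (z 1 / z 0, z 2 / z 0, z 3 / z 0) i = z i"
        using z by (auto simp: g_def proj_space_def)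
    qed
    moreover have "open {u. g u \<in> T}"
    proof (rule zariski_open_vimage_euclidean[OF T])
      fix i :: nat
      have "i = 0 \<or> i = 1 \<or> i = 2 \<or> i = 3 \<or> i > 3" by linarith
      then show "continuous_on UNIV (\<lambda>u. g u i)"
        by (auto simp: g_def case_prod_unfold intro!: continuous_intros)
    next
      show "g u \<in> proj_space 3" for u
        using z by (auto simp: g_def proj_space_def case_prod_unfold intro!: exI[of _ 0])
    qed
    ultimately obtain x y t where gT: "g (x, y, t) \<in> T"
      and S: "(x, y, t) \<in> delsarte_double_plane p q r s c d"
      and nz: "x \<noteq> 0" "y \<noteq> 0" "t \<noteq> 0"
      using delsarte_torus_dense[OF \<open>q < p\<close> _ _ z(3), of "{u. g u \<in> T}"] \<open>z \<in> T\<close>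
      by auto
    define w where "w = (!) [2 * Ln y / of_nat m, of_nat p * Ln x / of_nat m,
      (of_nat q * Ln x + of_nat r * Ln t) / of_nat m, of_nat s * Ln t / of_nat m]"
    define X where "X i = (if i \<le> 3 then exp (w i) / \<kappa> i else 0)" for i
    have X: "X i \<noteq> 0" "\<kappa> i * X i = exp (w i)" if "i \<le> 3" for i
      using \<kappa>[OF that] that by (auto simp: X_def)
    obtain l where l: "l \<noteq> 0" "\<And>j. j \<le> 3 \<Longrightarrow> M X j = l * exp (\<Sum>i\<le>3. of_int (?E j i) * w i)"
      using M_exp[of X w, OF X] by blast
    have logs: "(\<Sum>i\<le>3. of_int (?E 1 i) * w i) = Ln x" "(\<Sum>i\<le>3. of_int (?E 2 i) * w i) = Ln y"
      "(\<Sum>i\<le>3. of_int (?E 3 i) * w i) = Ln t"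
      using delsarte_exponents_invert[where a = "Ln x" and b = "Ln y" and t = "Ln t" and p = p
        and q = q and r = r and s = s and \<sigma> = \<sigma>] m unfolding m_eq w_def by auto
    have "same_point (g (x, y, t)) (M X)"
      unfolding same_point_def
    proof (intro exI[of _ "l / z 0"] conjI ext)
      show "l / z 0 \<noteq> 0" using l z by simp
      fix i :: nat
      have "i = 0 \<or> i = 1 \<or> i = 2 \<or> i = 3 \<or> i > 3" by linarith
      then show "M X i = l / z 0 * g (x, y, t) i"
        using l z nz M logs E0[of w] by (auto simp: g_def form_map_def)
    qed
    then have "M X \<in> T" using zariski_open_same_point[OF T] gT by blast
    moreover have "X \<in> U"
    proof -
      have pow: "X i ^ m = exp (of_nat m * w i) / \<kappa> i ^ m" if "i \<le> 3" for i
        using that by (simp add: X_def power_divide exp_of_nat_mult)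
      \<comment> \<open>The powers \<open>X\<^sub>i\<^sup>m\<close> are exactly the four terms of the equation, moved to one side.\<close>
      have "X 0 ^ m = - (y ^ 2)" "X 1 ^ m = x ^ p" "X 2 ^ m = c * (x ^ q * t ^ r)" "X 3 ^ m = d * t ^ s"
        using m nz
        by (simp_all add: pow \<kappa>_simps \<kappa>_simps(2)[simplified] roots)
          (simp_all add: w_def exp_add exp_of_nat_mult exp_double)
      then have "X 0 ^ m + X 1 ^ m + X 2 ^ m + X 3 ^ m = 0"
        using S by (simp add: delsarte_double_plane_def)
      then show ?thesis
        using X by (auto simp: U_def fermat_surface_def proj_space_def X_def intro!: exI[of _ 0])
    qed
    ultimately show ?thesis by blast
  qed
  have "covers 3 ?F 3 ?S"
    unfolding covers_def
  proof (intro exI[of _ U] exI[of _ M] conjI)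
    have "form 3 (\<Sum>i\<le>(3::nat). 1) (\<lambda>x. \<Prod>i\<le>3. x i)" by (rule form_prod) (rule form.coord)
    note openin_zariski_basic[OF this]
    moreover have "U = ?F \<inter> {x \<in> proj_space 3. (\<Prod>i\<le>3. x i) \<noteq> 0}"
      by (auto simp: U_def fermat_surface_def)
    ultimately have "openin (subtopology (zariski 3) ?F) U"
      unfolding openin_subtopology by blast
    moreover have "U \<noteq> {}"
    proof -
      obtain y where y: "y ^ 2 = 1 + c + d" using power2_csqrt by blast
      have "(\<lambda>i. if i \<le> 3 then [1, 1, y, 1] ! i else 0) \<in> ?S"
        by (auto simp: affine_chart_def proj_space_def delsarte_double_plane_def y intro!: exI[of _ 0])
      moreover from this have "(\<lambda>i. if i \<le> 3 then [1, 1, y, 1] ! i else 0) \<in> proj_space 3"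
        by (simp add: affine_chart_def)
      ultimately show ?thesis using dense[of "proj_space 3"] openin_topspace[of "zariski 3"] by auto
    qed
    ultimately show "nonempty_open_in 3 ?F U" by (simp add: nonempty_open_in_def)
    show "regular_map 3 U 3 ?S M"
      unfolding regular_map_def
    proof (intro conjI ballI)
      fix x assume x: "x \<in> U"
      then show "M x \<in> ?S" by (rule M_surface)
      have "x \<in> proj_space 3" using x by (simp add: U_def fermat_surface_def)
      moreover have "same_point (M z) (M z)" for z by (auto simp: same_point_def intro!: exI[of _ 1])
      ultimately show "\<exists>W d F. openin (zariski 3) W \<and> x \<in> W \<and> form_map 3 3 d F \<and>
          (\<forall>z\<in>U \<inter> W. same_point (F z) (M z))"
        using M openin_topspace[of "zariski 3"] by (metis topspace_zariski)
    qed
    show "?S \<subseteq> zariski 3 closure_of (M ` U)"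
      using dense by (auto simp: in_closure_of affine_chart_def)
  qed
  then show ?thesis by (simp add: m_def)
qed

section \<open>The K3 surfaces\<close>

lemma K3_affine_delsarte:
  "K3_affine 66 = delsarte_double_plane 3 0 12 1 (-1) (-1)"
  "K3_affine 44 = delsarte_double_plane 3 1 0 11 1 1"
  "K3_affine 42 = delsarte_double_plane 3 0 12 5 (-1) (-1)"
  "K3_affine 36 = delsarte_double_plane 3 0 11 5 (-1) (-1)"
  "K3_affine 28 = delsarte_double_plane 3 1 0 7 1 1"
  "K3_affine 12 = delsarte_double_plane 3 0 7 5 1 1"
  "K3_affine 19 = delsarte_double_plane 3 1 7 1 1 (-1)"
  "K3_affine 17 = delsarte_double_plane 3 1 7 2 1 (-1)"
  "K3_affine 13 = delsarte_double_plane 3 1 5 1 1 (-1)"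
  "K3_affine 11 = delsarte_double_plane 3 1 5 2 1 (-1)"
  "K3_affine 7 = delsarte_double_plane 3 1 3 8 1 (-1)"
  "K3_affine 5 = delsarte_double_plane 3 1 3 7 1 (-1)"
  "K3_affine 27 = delsarte_double_plane 3 0 10 1 (-1) (-1)"
  "K3_affine 9 = delsarte_double_plane 3 0 8 5 (-1) (-1)"
  "K3_affine 25 = delsarte_double_plane 5 1 5 0 1 (-1)"
  by (simp_all add: K3_affine_def K3_rhs_def delsarte_double_plane_def algebra_simps flip: power_add power_Suc)

theorem theorem5:
  fixes k n :: nat and X :: "(nat \<Rightarrow> complex) set"
  assumes "k \<in> unimodular_orders \<union> non_unimodular_orders"
    and "K3_model k n X"
    and "k \<noteq> 3"
  shows "covers 3 (fermat_surface (if k \<in> unimodular_orders then k else 2 * k)) n X"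
proof -
  have X: "birational n X 3 (affine_chart (K3_affine k))" "projective_variety n X"
    using assms(2) unfolding K3_model_def smooth_minimal_projective_model_def minimal_surface_def
      smooth_projective_surface_def by auto
  have cover: "covers 3 (fermat_surface (nat (2 * \<bar>int p * (int r - int s) + int q * int s\<bar>))) n X"
    if "K3_affine j = delsarte_double_plane p q r s c d" "k = j" "q < p" "c \<noteq> 0" "d \<noteq> 0"
      "int p * (int r - int s) + int q * int s \<noteq> 0" for j p q r s c d
    using covers_birational[OF fermat_covers_delsarte] X that by metis
  consider "k = 66" | "k = 44" | "k = 42" | "k = 36" | "k = 28" | "k = 12"
    | "k = 19" | "k = 17" | "k = 13" | "k = 11" | "k = 7" | "k = 5" | "k = 27" | "k = 9" | "k = 25"
    using assms(1,3) unfolding unimodular_orders_def non_unimodular_orders_def by auto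
  then show ?thesis
    by cases (simp_all add: unimodular_orders_def K3_affine_delsarte[THEN cover, simplified])
qed

end
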